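(* Consider two fractional Ornstein-Uhlenbeck processes with the same mean-reversion speed $\alpha\in\mathbb R$ and Hurst indices $\frac12<H_1<H_2<1$, and let $0<T_1<T_2$. Then, for every $0<s<T_1$, $$\begin{vmatrix} c_{H_1}s^{\frac12-H_1}\int_s^{T_1}e^{\alpha(T_1-u)}\varphi_{H_1}(u,s)\,du & c_{H_2}s^{\frac12-H_2}\int_s^{T_1}e^{\alpha(T_1-u)}\varphi_{H_2}(u,s)\,du\\[4pt] c_{H_1}s^{\frac12-H_1}\int_s^{T_2}e^{\alpha(T_2-u)}\varphi_{H_1}(u,s)\,du & c_{H_2}s^{\frac12-H_2}\int_s^{T_2}e^{\alpha(T_2-u)}\varphi_{H_2}(u,s)\,du \end{vmatrix}\neq0 .$$
   Context: For $H\in(\frac12,1)$, $$\varphi_H(u,s):=u^{H-\frac12}(u-s)^{H-\frac32},\qquad c_H:=\left(H-\tfrac12\right)\left(\frac{2H\,\Gamma(\frac32-H)}{\Gamma(H+\frac12)\Gamma(2-2H)}\right)^{\frac12}.$$ Fractional Brownian motion with Hurst index $H$ is represented as $B^H_t=c_H\int_0^ts^{\frac12-H}\int_s^t\varphi_H(u,s)\,du\,dW_s$ with $W$ a Wiener process. The fractional Ornstein-Uhlenbeck process with mean-reversion speed $\alpha$ is $Y_t=\alpha\int_0^tY_s\,ds+B^H_t$, a Gaussian Volterra process with kernel $K_Y(t,s)=c_Hs^{\frac12-H}\int_s^te^{\alpha(t-u)}\varphi_H(u,s)\,du$; the determinant's entries are these kernels evaluated at $(T_j,s)$. *)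

theory Defs
  imports "HOL-Analysis.Analysis"
begin

definition fbm_phi :: "real \<Rightarrow> real \<Rightarrow> real \<Rightarrow> real" where
  "fbm_phi H u s = u powr (H - 1/2) * (u - s) powr (H - 3/2)"

definition fbm_const :: "real \<Rightarrow> real" where
  "fbm_const H =
     (H - 1/2) * sqrt (2 * H * Gamma (3/2 - H) / (Gamma (H + 1/2) * Gamma (2 - 2 * H)))"

text \<open>
  The Volterra kernel, with respect to the driving Wiener process, of the fractional
  Ornstein-Uhlenbeck process with mean-reversion speed \<open>\<alpha>\<close> and Hurst index \<open>H\<close>.
  It is meant for \<open>1/2 < H < 1\<close> and \<open>0 < s < t\<close>. The integrand is then singular only at the
  end point \<open>u = s\<close>, and integrable because \<open>H - 3/2 > -1\<close>; the value \<open>0 powr a = 0\<close> at that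
  point does not affect the Lebesgue integral.
\<close>

definition fou_kernel :: "real \<Rightarrow> real \<Rightarrow> real \<Rightarrow> real \<Rightarrow> real" where
  "fou_kernel \<alpha> H t s =
     fbm_const H * s powr (1/2 - H) * (LBINT u:{s..t}. exp (\<alpha> * (t - u)) * fbm_phi H u s)"

end

(*
  The ratio phi_{H2}/phi_{H1} equals (u (u - s)) powr (H2 - H1), which is strictly increasing
  in u > s.  Hence the quotient of the two kernel integrals over (s, T] is strictly increasing
  in T, so the rows of the matrix are not proportional.
*)
theory Submission
  imports Defs
begin

text \<open>A nonnegative integrand with zero integral vanishes almost everywhere; as
  \<open>f\<close> is positive on all of \<open>A\<close>, this would make \<open>A\<close> a null
  set.\<close>

lemma set_integral_pos:
  fixes f :: "'a \<Rightarrow> real"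
  assumes int: "set_integrable M A f" and A: "A \<in> sets M" "emeasure M A \<noteq> 0"
    and pos: "\<And>x. x \<in> A \<Longrightarrow> 0 < f x"
  shows "0 < (LINT x:A|M. f x)"
proof -
  have ge: "0 \<le> (LINT x:A|M. f x)"
    unfolding set_lebesgue_integral_def
    using pos by (intro Bochner_Integration.integral_nonneg) (auto simp: indicator_def intro: less_imp_le)
  have "(LINT x:A|M. f x) \<noteq> 0"
  proof
    assume "(LINT x:A|M. f x) = 0"
    moreover have "AE x in M. 0 \<le> indicator A x *\<^sub>R f x"
      using pos by (auto simp: indicator_def intro: less_imp_le)
    ultimately have "AE x in M. indicator A x *\<^sub>R f x = 0"
      using int integral_nonneg_eq_0_iff_AE
      unfolding set_integrable_def set_lebesgue_integral_def by blast
    then have "AE x in M. x \<notin> A"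
      by eventually_elim (use pos in force)
    then have "emeasure M A = 0"
      using A(1) by (simp add: null_setsD1 flip: AE_iff_null_sets)
    with A(2) show False by simp
  qed
  with ge show ?thesis by simp
qed

text \<open>Splitting the integrals over \<open>A \<union> B\<close> gives both sides the same
  product of integrals over \<open>A\<close>, which cancels. The remaining cross terms compare the
  \<open>f\<close>-weighted means of \<open>g\<close> over \<open>A\<close> and over
  \<open>B\<close>, and \<open>k\<close> separates these two means.\<close>

lemma set_integral_weight_strict_mono:
  fixes f g :: "'a \<Rightarrow> real"
  assumes disj: "A \<inter> B = {}"
    and meas: "A \<in> sets M" "B \<in> sets M" "emeasure M A \<noteq> 0" "emeasure M B \<noteq> 0"
    and f: "set_integrable M (A \<union> B) f"
    and gf: "set_integrable M (A \<union> B) (\<lambda>x. g x * f x)"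
    and pos: "\<And>x. x \<in> A \<union> B \<Longrightarrow> 0 < f x"
    and gA: "\<And>x. x \<in> A \<Longrightarrow> g x \<le> k" and gB: "\<And>x. x \<in> B \<Longrightarrow> k < g x"
  shows "(LINT x:A|M. g x * f x) * (LINT x:A \<union> B|M. f x)
       < (LINT x:A|M. f x) * (LINT x:A \<union> B|M. g x * f x)"
proof -
  note sub = set_integrable_subset[OF f] set_integrable_subset[OF gf]
  have fA: "set_integrable M A f" and fB: "set_integrable M B f"
    and gfA: "set_integrable M A (\<lambda>x. g x * f x)" and gfB: "set_integrable M B (\<lambda>x. g x * f x)"
    using sub meas by auto
  let ?a = "LINT x:A|M. f x" and ?b = "LINT x:B|M. f x"
  let ?c = "LINT x:A|M. g x * f x" and ?d = "LINT x:B|M. g x * f x"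
  have a: "0 < ?a" and b: "0 < ?b"
    using meas pos fA fB by (auto intro!: set_integral_pos)
  have "?c \<le> (LINT x:A|M. k * f x)"
    using gA pos by (intro set_integral_mono gfA set_integrable_mult_right fA)
      (auto intro!: mult_right_mono less_imp_le)
  then have c: "?c \<le> k * ?a" by simp
  \<comment> \<open>The strictness of the conclusion originates here: \<open>(g - k) * f\<close> is
    positive on the non-null set \<open>B\<close>.\<close>
  have "0 < (LINT x:B|M. g x * f x - k * f x)"
    using gB pos meas fB by (intro set_integral_pos set_integral_diff(1) gfB) auto
  then have d: "k * ?b < ?d"
    using gfB fB by (simp add: set_integral_diff(2))
  have "?c * ?b \<le> k * ?a * ?b" using c b by (intro mult_right_mono) auto
  also have "\<dots> = ?a * (k * ?b)" by simp
  also have "\<dots> < ?a * ?d" using d a by (intro mult_strict_left_mono)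
  finally show ?thesis
    using set_integral_Un[OF disj fA fB] set_integral_Un[OF disj gfA gfB]
    by (simp add: algebra_simps)
qed

lemma set_integrable_powr_shift:
  fixes a s t :: real
  assumes "a > -1" "s \<le> t"
  shows "set_integrable lborel {s<..t} (\<lambda>u. (u - s) powr a)"
proof -
  have "(\<lambda>x::real. x powr a) absolutely_integrable_on {0<..t - s}"
    using assms by (intro nonnegative_absolutely_integrable_1 integrable_on_powr_from_0') auto
  \<comment> \<open>Absolute integrability refers to the completed measure; for a Borel measurable
    function it passes down to \<open>lborel\<close>.\<close>
  then have "integrable lborel (\<lambda>x. indicator {0<..t - s} x *\<^sub>R x powr a)"
    unfolding set_integrable_def by (subst (asm) integrable_completion) auto
  from lborel_integrable_real_affine[OF this, of 1 "-s"]
  have "integrable lborel (\<lambda>u. indicator {0<..t - s} (u - s) *\<^sub>R (u - s) powr a)"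
    by simp
  also have "(\<lambda>u. indicator {0<..t - s} (u - s) *\<^sub>R (u - s) powr a)
      = (\<lambda>u. indicator {s<..t} u *\<^sub>R (u - s) powr a)"
    by (auto simp: indicator_def)
  finally show ?thesis unfolding set_integrable_def .
qed

lemma fbm_phi_pos: "0 < s \<Longrightarrow> s < u \<Longrightarrow> 0 < fbm_phi H u s"
  by (simp add: fbm_phi_def)

text \<open>Changing the Hurst index shifts the exponents of \<open>u\<close> and of
  \<open>u - s\<close> by the same amount, so the two powers merge into one.\<close>

lemma fbm_phi_ratio:
  assumes "0 < s" "s < u"
  shows "fbm_phi H' u s = (u * (u - s)) powr (H' - H) * fbm_phi H u s"
  using assms by (simp add: fbm_phi_def powr_mult mult.assoc mult.left_commute flip: powr_add)

text \<open>The exponential and \<open>u powr (H - 1/2)\<close> are bounded on the interval, the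
  latter because its exponent is positive. What remains is the singularity at \<open>s\<close>, of
  order \<open>H - 3/2 > -1\<close>.\<close>

lemma set_integrable_exp_fbm_phi:
  assumes H: "1/2 < H" and s: "0 < s" "s \<le> t"
  shows "set_integrable lborel {s<..t} (\<lambda>u. exp (- \<alpha> * u) * fbm_phi H u s)"
proof (rule set_integrable_bound)
  let ?C = "exp (\<bar>\<alpha>\<bar> * t) * t powr (H - 1/2)"
  show "set_integrable lborel {s<..t} (\<lambda>u. ?C * (u - s) powr (H - 3/2))"
    using H s by (intro set_integrable_mult_right set_integrable_powr_shift) auto
  show "set_borel_measurable lborel {s<..t} (\<lambda>u. exp (- \<alpha> * u) * fbm_phi H u s)"
    unfolding set_borel_measurable_def fbm_phi_def by measurable
  have "exp (- \<alpha> * u) * fbm_phi H u s \<le> ?C * (u - s) powr (H - 3/2)"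
    if u: "s < u" "u \<le> t" for u
  proof -
    have "- \<alpha> * u \<le> \<bar>\<alpha>\<bar> * u"
      using u s by (intro mult_right_mono) auto
    also have "\<dots> \<le> \<bar>\<alpha>\<bar> * t"
      using u by (intro mult_left_mono) auto
    finally have "exp (- \<alpha> * u) * u powr (H - 1/2) \<le> ?C"
      using u s H by (intro mult_mono powr_mono2) auto
    then show ?thesis
      unfolding fbm_phi_def mult.assoc[symmetric] by (intro mult_right_mono) auto
  qed
  then show "AE u in lborel. u \<in> {s<..t} \<longrightarrow>
      norm (exp (- \<alpha> * u) * fbm_phi H u s) \<le> norm (?C * (u - s) powr (H - 3/2))"
    using s fbm_phi_pos[of s _ H] by (auto simp: abs_mult abs_of_pos)
qed

text \<open>Pulling out \<open>exp (\<alpha> * t)\<close> leaves an integrand independent of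
  \<open>t\<close>, so the kernels at two times involve integrals of one function over nested
  intervals.\<close>

lemma fou_kernel_factor:
  "fou_kernel \<alpha> H t s =
     fbm_const H * s powr (1/2 - H) * exp (\<alpha> * t)
       * (LBINT u:{s<..t}. exp (- \<alpha> * u) * fbm_phi H u s)"
proof -
  \<comment> \<open>Dropping the end point \<open>s\<close> keeps the integrands equal pointwise,
    since \<open>0 powr a = 0\<close> there.\<close>
  have "(LBINT u:{s..t}. exp (\<alpha> * (t - u)) * fbm_phi H u s)
      = (LBINT u:{s<..t}. exp (\<alpha> * t) * (exp (- \<alpha> * u) * fbm_phi H u s))"
    unfolding set_lebesgue_integral_def
    by (intro Bochner_Integration.integral_cong)
      (auto simp: indicator_def fbm_phi_def algebra_simps simp flip: exp_add)
  then show ?thesis by (simp add: fou_kernel_def)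
qed

lemma fbm_const_pos:
  assumes "1/2 < H" "H < 1"
  shows "0 < fbm_const H"
  using assms unfolding fbm_const_def
  by (intro mult_pos_pos real_sqrt_gt_zero divide_pos_pos Gamma_real_pos) auto

theorem proposition19:
  fixes \<alpha> H\<^sub>1 H\<^sub>2 T\<^sub>1 T\<^sub>2 :: real
  assumes "1/2 < H\<^sub>1" and "H\<^sub>1 < H\<^sub>2" and "H\<^sub>2 < 1"
    and "0 < T\<^sub>1" and "T\<^sub>1 < T\<^sub>2"
  shows "\<forall>s. 0 < s \<and> s < T\<^sub>1 \<longrightarrow>
    det (vector [vector [fou_kernel \<alpha> H\<^sub>1 T\<^sub>1 s, fou_kernel \<alpha> H\<^sub>2 T\<^sub>1 s],
                 vector [fou_kernel \<alpha> H\<^sub>1 T\<^sub>2 s, fou_kernel \<alpha> H\<^sub>2 T\<^sub>2 s]] :: real ^ 2 ^ 2) \<noteq> 0"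
proof (intro allI impI)
  fix s :: real
  assume "0 < s \<and> s < T\<^sub>1"
  then have s: "0 < s" "s < T\<^sub>1" by auto
  define f where "f = (\<lambda>H u. exp (- \<alpha> * u) * fbm_phi H u s)"
  define g where "g = (\<lambda>u. (u * (u - s)) powr (H\<^sub>2 - H\<^sub>1))"
  define I where "I = (\<lambda>H t. LBINT u:{s<..t}. f H u)"
  define c where "c = (\<lambda>H. fbm_const H * s powr (1/2 - H))"
  have kernel: "fou_kernel \<alpha> H t s = c H * exp (\<alpha> * t) * I H t" for H t
    unfolding fou_kernel_factor c_def I_def f_def ..
  have Un: "{s<..T\<^sub>1} \<union> {T\<^sub>1<..T\<^sub>2} = {s<..T\<^sub>2}"
    using s assms by auto
  have f2: "f H\<^sub>2 u = g u * f H\<^sub>1 u" if "s < u" for u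
    using s that fbm_phi_ratio[of s u H\<^sub>2 H\<^sub>1] by (simp add: f_def g_def)
  have I2: "I H\<^sub>2 t = (LBINT u:{s<..t}. g u * f H\<^sub>1 u)" for t
    unfolding I_def by (intro set_lebesgue_integral_cong) (auto simp: f2)
  have int: "set_integrable lborel {s<..T\<^sub>2} (f H)" if "1/2 < H" for H
    using set_integrable_exp_fbm_phi[OF that, of s T\<^sub>2 \<alpha>] s assms by (simp add: f_def)
  have "set_integrable lborel {s<..T\<^sub>2} (f H\<^sub>2)"
    using int assms by simp
  also have "?this \<longleftrightarrow> set_integrable lborel {s<..T\<^sub>2} (\<lambda>u. g u * f H\<^sub>1 u)"
    by (intro set_integrable_cong) (auto simp: f2)
  finally have int2: "set_integrable lborel {s<..T\<^sub>2} (\<lambda>u. g u * f H\<^sub>1 u)" .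
  have less: "I H\<^sub>2 T\<^sub>1 * I H\<^sub>1 T\<^sub>2 < I H\<^sub>1 T\<^sub>1 * I H\<^sub>2 T\<^sub>2"
    \<comment> \<open>\<open>I2\<close> comes first, so that \<open>I H\<^sub>2\<close> becomes a
      \<open>g\<close>-weighted integral of \<open>f H\<^sub>1\<close> before \<open>I_def\<close>
      could expand it.\<close>
    unfolding I2 unfolding I_def Un[symmetric]
  \<comment> \<open>The weight \<open>g\<close> is strictly increasing beyond \<open>s\<close>, so
    its value at the cut point \<open>T\<^sub>1\<close> separates the two intervals;
    \<open>T\<^sub>1\<close> lies in the left one, where only the weak bound is required.\<close>
  proof (rule set_integral_weight_strict_mono[where k = "g T\<^sub>1"])
    show "g u \<le> g T\<^sub>1" if "u \<in> {s<..T\<^sub>1}" for u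
      unfolding g_def using s that assms by (intro powr_mono2 mult_mono) auto
    show "g T\<^sub>1 < g u" if "u \<in> {T\<^sub>1<..T\<^sub>2}" for u
      unfolding g_def using s that assms by (intro powr_less_mono2 mult_strict_mono) auto
    show "0 < f H\<^sub>1 u" if "u \<in> {s<..T\<^sub>1} \<union> {T\<^sub>1<..T\<^sub>2}" for u
      unfolding f_def using s that by (auto intro!: mult_pos_pos fbm_phi_pos)
  qed (use s assms int[of H\<^sub>1] int2 in \<open>auto simp: Un\<close>)
  have "c H\<^sub>1 > 0" "c H\<^sub>2 > 0"
    using s assms fbm_const_pos by (auto simp: c_def)
  then have pos: "c H\<^sub>1 * c H\<^sub>2 * exp (\<alpha> * T\<^sub>1) * exp (\<alpha> * T\<^sub>2) > 0"
    by simp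
  \<comment> \<open>Each column carries a factor \<open>c H\<close> and each row a factor
    \<open>exp (\<alpha> * T)\<close>; all are positive, so the sign is that of the determinant of
    the integrals \<open>I\<close>.\<close>
  have "det (vector [vector [fou_kernel \<alpha> H\<^sub>1 T\<^sub>1 s, fou_kernel \<alpha> H\<^sub>2 T\<^sub>1 s],
                 vector [fou_kernel \<alpha> H\<^sub>1 T\<^sub>2 s, fou_kernel \<alpha> H\<^sub>2 T\<^sub>2 s]] :: real ^ 2 ^ 2)
      = c H\<^sub>1 * c H\<^sub>2 * exp (\<alpha> * T\<^sub>1) * exp (\<alpha> * T\<^sub>2)
        * (I H\<^sub>1 T\<^sub>1 * I H\<^sub>2 T\<^sub>2 - I H\<^sub>2 T\<^sub>1 * I H\<^sub>1 T\<^sub>2)"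
    unfolding det_2 kernel by (simp add: algebra_simps)
  also have "\<dots> > 0"
    using pos less by simp
  finally show "det (vector [vector [fou_kernel \<alpha> H\<^sub>1 T\<^sub>1 s, fou_kernel \<alpha> H\<^sub>2 T\<^sub>1 s],
                 vector [fou_kernel \<alpha> H\<^sub>1 T\<^sub>2 s, fou_kernel \<alpha> H\<^sub>2 T\<^sub>2 s]] :: real ^ 2 ^ 2) \<noteq> 0"
    by simp
qed

end
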